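(* Let $p\in(0,1/2]$, let $X^n=(X_1,\dots,X_n)$ be i.i.d. $\mathrm{Ber}(p)$ (with distribution denoted $P$), let $d$ be the Hamming distortion on $\{0,1\}\times\{0,1\}$, and let $D\in[0,p]$. Then $$L_n^{\mathrm{mem,i}}(P,D)\ \ge\ 1-\frac{D}{p}\quad\text{(bits)}.$$
   Context: Hamming distortion: $d(x,y)=1$ if $x\ne y$ and $0$ otherwise; $d(x^n,y^n)=\frac1n\sum_{i=1}^nd(x_i,y_i)$. The optimal normalized leakage of (index-dependent) memoryless schemes is $$L_n^{\mathrm{mem,i}}(P,D)=\min\ \frac1n\mathcal{L}(X^n\to Y^n),$$ where the minimum is over conditional distributions of product form $P_{Y^n|X^n}=\prod_{i=1}^nP^{(i)}_{Y_i|X_i}$ (with $Y_i\in\{0,1\}$, and $P^{(i)}_{Y_i|X_i}$ allowed to depend on $i$) satisfying $\mathbf{E}[d(X^n,Y^n)]\le D$. Here $\mathcal{L}$ is the maximal leakage in bits: for random variables $X,Y$, $$\mathcal{L}(X\to Y)=\sup_{U-X-Y-\hat U}\log_2\frac{\Pr(U=\hat U)}{\max_uP_U(u)},$$ the supremum being over all $U,\hat U$ forming the indicated Markov chain and taking values in the same finite, but arbitrary, alphabet. *)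

theory Defs
  imports "HOL-Probability.Probability"
begin

text \<open>
  All alphabets are discrete, so the law of finitely many jointly distributed random variables is
  a pmf, and the random variables are functions on its sample space.
\<close>

text \<open>Cross-multiplied conditional independence of \<open>A\<close> and \<open>C\<close> given \<open>B\<close>.\<close>

definition markov_chain3 ::
  "'w pmf \<Rightarrow> ('w \<Rightarrow> 'a) \<Rightarrow> ('w \<Rightarrow> 'b) \<Rightarrow> ('w \<Rightarrow> 'c) \<Rightarrow> bool" where
  "markov_chain3 M A B C \<longleftrightarrow>
     (\<forall>a b c. measure_pmf.prob M {w. A w = a \<and> B w = b \<and> C w = c} * measure_pmf.prob M {w. B w = b} =
              measure_pmf.prob M {w. A w = a \<and> B w = b} * measure_pmf.prob M {w. B w = b \<and> C w = c})"

definition markov_chain4 ::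
  "'w pmf \<Rightarrow> ('w \<Rightarrow> 'a) \<Rightarrow> ('w \<Rightarrow> 'b) \<Rightarrow> ('w \<Rightarrow> 'c) \<Rightarrow> ('w \<Rightarrow> 'd) \<Rightarrow> bool" where
  "markov_chain4 M A B C D \<longleftrightarrow>
     markov_chain3 M A B (\<lambda>w. (C w, D w)) \<and> markov_chain3 M (\<lambda>w. (A w, B w)) C D"

text \<open>HOL's \<^term>\<open>log 2 0\<close> is \<open>0\<close>; here the logarithm of \<open>0\<close> is \<open>-\<infinity>\<close>.\<close>

definition log2_ereal :: "real \<Rightarrow> ereal" where
  "log2_ereal r = (if r > 0 then ereal (log 2 r) else - \<infinity>)"

text \<open>
  Maximal leakage (in bits) from the first to the second component of a pair with joint law
  \<open>Q\<close>. \<open>J\<close> is the joint law of \<open>(U, X, Y, V)\<close>, where \<open>V\<close> is the guess of \<open>U\<close>. Since HOL cannot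
  quantify over types inside a term, the arbitrary finite alphabet \<open>S\<close> of \<open>U\<close> and \<open>V\<close> is taken to
  be a finite set of natural numbers, which is no restriction up to relabelling.
\<close>

definition maximal_leakage :: "('x \<times> 'y) pmf \<Rightarrow> ereal" where
  "maximal_leakage Q =
     Sup {log2_ereal (measure_pmf.prob J {(u, x, y, v). u = v} /
                      Max ((\<lambda>s. measure_pmf.prob J {(u, x, y, v). u = s}) ` S))
          | (S :: nat set) (J :: (nat \<times> 'x \<times> 'y \<times> nat) pmf).
            finite S \<and>
            set_pmf J \<subseteq> {(u, x, y, v). u \<in> S \<and> v \<in> S} \<and>
            map_pmf (\<lambda>(u, x, y, v). (x, y)) J = Q \<and>
            markov_chain4 J (\<lambda>(u, x, y, v). u) (\<lambda>(u, x, y, v). x)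
                            (\<lambda>(u, x, y, v). y) (\<lambda>(u, x, y, v). v)}"

definition hamming :: "'a \<Rightarrow> 'a \<Rightarrow> real" where
  "hamming x y = (if x \<noteq> y then 1 else 0)"

definition hamming_n :: "nat \<Rightarrow> (nat \<Rightarrow> 'a) \<Rightarrow> (nat \<Rightarrow> 'a) \<Rightarrow> real" where
  "hamming_n n x y = (1 / real n) * (\<Sum>i<n. hamming (x i) (y i))"

text \<open>
  The binary alphabet is \<^typ>\<open>bool\<close>, with \<open>True\<close> for \<open>1\<close>. A word of length \<open>n\<close> is a function
  \<^typ>\<open>nat \<Rightarrow> bool\<close> with coordinates \<open>0, \<dots>, n - 1\<close> and the default value \<open>False\<close> elsewhere.
\<close>

definition iid_source :: "nat \<Rightarrow> bool pmf \<Rightarrow> (nat \<Rightarrow> bool) pmf" where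
  "iid_source n P = Pi_pmf {..<n} False (\<lambda>_. P)"

text \<open>\<open>W i x\<close> is the law of the \<open>i\<close>-th output bit given that the \<open>i\<close>-th input bit is \<open>x\<close>.\<close>

definition memoryless_channel ::
  "nat \<Rightarrow> (nat \<Rightarrow> bool \<Rightarrow> bool pmf) \<Rightarrow> (nat \<Rightarrow> bool) \<Rightarrow> (nat \<Rightarrow> bool) pmf" where
  "memoryless_channel n W x = Pi_pmf {..<n} False (\<lambda>i. W i (x i))"

definition joint_law :: "'x pmf \<Rightarrow> ('x \<Rightarrow> 'y pmf) \<Rightarrow> ('x \<times> 'y) pmf" where
  "joint_law P K = bind_pmf P (\<lambda>x. map_pmf (Pair x) (K x))"

text \<open>
  The minimum over admissible schemes is rendered as an infimum in the extended reals.
\<close>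

definition L_mem_i :: "nat \<Rightarrow> bool pmf \<Rightarrow> real \<Rightarrow> ereal" where
  "L_mem_i n P D =
     Inf {ereal (1 / real n) * maximal_leakage (joint_law (iid_source n P) (memoryless_channel n W))
          | W :: nat \<Rightarrow> bool \<Rightarrow> bool pmf.
            measure_pmf.expectation (joint_law (iid_source n P) (memoryless_channel n W))
              (\<lambda>(x, y). hamming_n n x y) \<le> D}"

end

theory Submission
  imports Defs
begin

text \<open>
  For a finitely supported input \<open>X\<close> and any estimator \<open>f\<close>, a suitable \<open>U\<close> shows that the leakage is
  at least \<open>log\<^sub>2 (\<Sum>\<^sub>x Pr (f Y = x | X = x))\<close>. For a memoryless scheme and a coordinatewise estimator this
  sum factorises; guessing \<open>X\<^sub>i = Y\<^sub>i\<close> or its negation, whichever is better, makes the \<open>i\<close>-th factor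
  \<open>1 + \<bar>a\<^sub>i - b\<^sub>i\<bar>\<close>, where \<open>a\<^sub>i\<close> and \<open>b\<^sub>i\<close> are the probabilities of output \<open>1\<close> given input \<open>1\<close> and \<open>0\<close>.
  By concavity \<open>log\<^sub>2 (1 + t) \<ge> t\<close> on \<open>[0, 1]\<close>, so the leakage is at least \<open>\<Sum>\<^sub>i (a\<^sub>i - b\<^sub>i)\<close>. The distortion
  \<open>d\<^sub>i = p (1 - a\<^sub>i) + (1 - p) b\<^sub>i\<close> is at least \<open>p (1 - (a\<^sub>i - b\<^sub>i))\<close> because \<open>p \<le> 1 - p\<close>, and averaging
  over \<open>i\<close> gives the bound.
\<close>

section \<open>Finite mixtures, product laws and a logarithm bound\<close>

lemma measure_bind_pmf_finite:
  assumes "finite (set_pmf P)"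
  shows "measure_pmf.prob (bind_pmf P N) A = (\<Sum>x\<in>set_pmf P. pmf P x * measure_pmf.prob (N x) A)"
proof -
  have "ennreal (measure_pmf.prob (bind_pmf P N) A) = (\<Sum>x\<in>set_pmf P. emeasure (N x) A * ennreal (pmf P x))"
    using assms by (simp add: measure_pmf.emeasure_eq_measure[symmetric] nn_integral_measure_pmf_finite)
  also have "\<dots> = ennreal (\<Sum>x\<in>set_pmf P. pmf P x * measure_pmf.prob (N x) A)"
    by (simp add: measure_pmf.emeasure_eq_measure ennreal_mult[symmetric] mult.commute)
  finally show ?thesis
    by (simp add: sum_nonneg)
qed

text \<open>Convexity of \<open>exp\<close> between \<open>0\<close> and \<open>ln 2\<close> puts
  \<open>2 powr t\<close> below its chord \<open>1 + t\<close>.\<close>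

lemma log2_one_plus_ge:
  assumes "0 \<le> t" "t \<le> 1"
  shows "t \<le> log 2 (1 + t)"
proof -
  have "exp ((1 - t) *\<^sub>R 0 + t *\<^sub>R ln 2) \<le> (1 - t) * exp 0 + t * exp (ln (2::real))"
    using assms by (intro convex_onD[OF exp_convex]) auto
  then have "2 powr t \<le> 1 + t"
    by (simp add: powr_def algebra_simps)
  with assms show ?thesis
    by (simp add: le_log_iff)
qed

lemma prob_pair_pmf_Times:
  "measure_pmf.prob (pair_pmf M N) (A \<times> B) = measure_pmf.prob M A * measure_pmf.prob N B"
proof -
  have "ennreal (measure_pmf.prob (pair_pmf M N) (A \<times> B)) =
      (\<integral>\<^sup>+x. \<integral>\<^sup>+y. indicator A x * indicator B y \<partial>N \<partial>M)"
    by (simp flip: measure_pmf.emeasure_eq_measure nn_integral_indicator add: nn_integral_pair_pmf' indicator_times)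
  also have "\<dots> = ennreal (measure_pmf.prob M A * measure_pmf.prob N B)"
    by (simp add: nn_integral_cmult nn_integral_multc measure_pmf.emeasure_eq_measure ennreal_mult)
  finally show ?thesis
    by simp
qed

section \<open>Couplings of a secret, the channel and a guess\<close>

text \<open>Given \<open>x\<close>, the secret \<open>u\<close> and the output \<open>y\<close> are
  drawn independently, and the guess is a function of \<open>y\<close>; this builds in the Markov
  chain.\<close>

definition leakage_coupling ::
  "'x pmf \<Rightarrow> ('x \<Rightarrow> 'u pmf) \<Rightarrow> ('x \<Rightarrow> 'y pmf) \<Rightarrow> ('y \<Rightarrow> 'v) \<Rightarrow> ('u \<times> 'x \<times> 'y \<times> 'v) pmf" where
  "leakage_coupling P R K h =
     bind_pmf P (\<lambda>x. map_pmf (\<lambda>(u, y). (u, x, y, h y)) (pair_pmf (R x) (K x)))"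

lemma map_leakage_coupling:
  "map_pmf (\<lambda>(u, x, y, v). (x, y)) (leakage_coupling P R K h) = joint_law P K"
proof -
  have "map_pmf (\<lambda>(u, y). (x, y)) (pair_pmf (R x) (K x)) =
      map_pmf (Pair x) (map_pmf snd (pair_pmf (R x) (K x)))" for x
    by (simp add: pmf.map_comp o_def case_prod_unfold)
  then show ?thesis
    by (simp add: leakage_coupling_def joint_law_def map_bind_pmf pmf.map_comp o_def case_prod_unfold
        map_snd_pair_pmf)
qed

lemma prob_leakage_coupling:
  assumes "finite (set_pmf P)"
  shows "measure_pmf.prob (leakage_coupling P R K h) S =
    (\<Sum>x\<in>set_pmf P. pmf P x * measure_pmf.prob (pair_pmf (R x) (K x)) {(u, y). (u, x, y, h y) \<in> S})"
  using assms by (simp add: leakage_coupling_def measure_bind_pmf_finite vimage_def case_prod_unfold)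

text \<open>With \<open>A\<close> and \<open>C\<close> taken as singletons or \<open>UNIV\<close>,
  this covers all four probabilities in the first Markov condition.\<close>

lemma prob_leakage_coupling_Times:
  assumes "finite (set_pmf P)"
  shows "measure_pmf.prob (leakage_coupling P R K h) {w. fst w \<in> A \<and> fst (snd w) = b \<and> snd (snd w) \<in> C} =
    pmf P b * (measure_pmf.prob (R b) A * measure_pmf.prob (K b) {y. (y, h y) \<in> C})"
proof -
  have Times_eq_Collect: "A \<times> {y. (y, h y) \<in> C} = {z. fst z \<in> A \<and> (snd z, h (snd z)) \<in> C}"
    by auto
  have "measure_pmf.prob (pair_pmf (R x) (K x)) {z. fst z \<in> A \<and> x = b \<and> (snd z, h (snd z)) \<in> C} =
     (if x = b then measure_pmf.prob (R b) A * measure_pmf.prob (K b) {y. (y, h y) \<in> C} else 0)" for x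
    using prob_pair_pmf_Times[of "R b" "K b" A "{y. (y, h y) \<in> C}"]
    by (simp add: Times_eq_Collect case_prod_unfold)
  then show ?thesis using assms
    by (simp add: prob_leakage_coupling case_prod_unfold set_pmf_iff if_distrib[of "\<lambda>x. _ * x"] cong: if_cong)
qed

lemma markov_chain4_leakage_coupling:
  assumes "finite (set_pmf P)"
  shows "markov_chain4 (leakage_coupling P R K h) (\<lambda>(u, x, y, v). u) (\<lambda>(u, x, y, v). x)
    (\<lambda>(u, x, y, v). y) (\<lambda>(u, x, y, v). v)"
proof -
  let ?J = "leakage_coupling P R K h"
  have "markov_chain3 ?J fst (\<lambda>w. fst (snd w)) (\<lambda>w. snd (snd w))"
    unfolding markov_chain3_def
  proof (intro allI)
    fix a b c
    show "measure_pmf.prob ?J {w. fst w = a \<and> fst (snd w) = b \<and> snd (snd w) = c} *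
            measure_pmf.prob ?J {w. fst (snd w) = b} =
          measure_pmf.prob ?J {w. fst w = a \<and> fst (snd w) = b} *
            measure_pmf.prob ?J {w. fst (snd w) = b \<and> snd (snd w) = c}"
      using prob_leakage_coupling_Times[OF assms, of R K h "{a}" b "{c}"]
        prob_leakage_coupling_Times[OF assms, of R K h UNIV b UNIV]
        prob_leakage_coupling_Times[OF assms, of R K h "{a}" b UNIV]
        prob_leakage_coupling_Times[OF assms, of R K h UNIV b "{c}"]
      by simp
  qed
  moreover have "markov_chain3 ?J (\<lambda>w. (fst w, fst (snd w))) (\<lambda>w. fst (snd (snd w))) (\<lambda>w. snd (snd (snd w)))"
    unfolding markov_chain3_def
  proof (intro allI)
    fix a b c
    have v: "snd (snd (snd w)) = h (fst (snd (snd w)))" if "w \<in> set_pmf ?J" for w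
      using that by (auto simp: leakage_coupling_def)
    \<comment> \<open>On the support the guess is \<open>h\<close> of the output, so once the output
      is \<open>b\<close>, the event that the guess is \<open>c\<close> is either sure or
      impossible.\<close>
    have eq: "measure_pmf.prob ?J {w. Q w \<and> fst (snd (snd w)) = b \<and> snd (snd (snd w)) = c} =
        (if c = h b then measure_pmf.prob ?J {w. Q w \<and> fst (snd (snd w)) = b} else 0)" for Q
    proof -
      have "measure_pmf.prob ?J {w. Q w \<and> fst (snd (snd w)) = b \<and> snd (snd (snd w)) = c} =
          measure_pmf.prob ?J {w. Q w \<and> fst (snd (snd w)) = b \<and> c = h b}"
        using v by (intro measure_pmf.finite_measure_eq_AE) (auto simp: AE_measure_pmf_iff)
      then show ?thesis
        by simp
    qed
    show "measure_pmf.prob ?J {w. (fst w, fst (snd w)) = a \<and> fst (snd (snd w)) = b \<and> snd (snd (snd w)) = c} *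
            measure_pmf.prob ?J {w. fst (snd (snd w)) = b} =
          measure_pmf.prob ?J {w. (fst w, fst (snd w)) = a \<and> fst (snd (snd w)) = b} *
            measure_pmf.prob ?J {w. fst (snd (snd w)) = b \<and> snd (snd (snd w)) = c}"
      using eq[of "\<lambda>w. (fst w, fst (snd w)) = a"] eq[of "\<lambda>_. True"] by simp
  qed
  ultimately show ?thesis
    by (simp add: markov_chain4_def case_prod_unfold)
qed

lemma log2_ereal_mono: "a \<le> b \<Longrightarrow> log2_ereal a \<le> log2_ereal b"
  by (auto simp: log2_ereal_def)

section \<open>Leakage lower bound from an estimator\<close>

text \<open>For the constructed \<open>U\<close>, a correct guess has probability at least
  \<open>q\<close> times the sum and no value of \<open>U\<close> is likelier than \<open>q\<close>,
  so \<open>q\<close> cancels in the ratio. Finite support lets \<open>q\<close> be a positive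
  minimum.\<close>

lemma maximal_leakage_joint_law_ge:
  assumes fin: "finite (set_pmf P)"
    and f: "\<And>y. f y \<in> set_pmf P"
  shows "log2_ereal (\<Sum>x\<in>set_pmf P. measure_pmf.prob (K x) {y. f y = x}) \<le> maximal_leakage (joint_law P K)"
proof -
  define m where "m = card (set_pmf P)"
  obtain e where e: "bij_betw e (set_pmf P) {0..<m}"
    using ex_bij_betw_finite_nat[OF fin] by (auto simp: m_def)
  have e_less: "e x < m" if "x \<in> set_pmf P" for x
    using bij_betwE[OF e] that by auto
  have e_eq: "e x = e x' \<longleftrightarrow> x = x'" if "x \<in> set_pmf P" "x' \<in> set_pmf P" for x x'
    using bij_betw_imp_inj_on[OF e] that by (auto dest: inj_onD)
  define q where "q = Min (pmf P ` set_pmf P)"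
  have q_le: "q \<le> pmf P x" if "x \<in> set_pmf P" for x
    using that fin by (auto simp: q_def)
  have "q \<in> pmf P ` set_pmf P"
    unfolding q_def using fin by (intro Min_in) (auto simp: set_pmf_not_empty)
  then have q_pos: "0 < q"
    by (auto simp: pmf_positive)
  \<comment> \<open>Enough filler symbols that a uniform one has probability at most
    \<open>q\<close>.\<close>
  obtain N :: nat where N: "1 / q < real N"
    using reals_Archimedean2 by blast
  then have N_pos: "0 < N"
    using q_pos by (cases N) (auto simp: not_less)
  have N_q: "1 / real N \<le> q"
    using N N_pos q_pos by (simp add: field_simps)
  \<comment> \<open>Given \<open>X = x\<close>, \<open>U\<close> names \<open>x\<close> with probability \<open>q / P(x)\<close> and is otherwise one of \<open>N\<close> uninformative
    symbols. So each name has probability exactly \<open>q\<close>, and no symbol is more likely than that.\<close>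
  define R where "R x = bind_pmf (bernoulli_pmf (q / pmf P x))
    (\<lambda>b. if b then return_pmf (e x) else pmf_of_set {m..<m + N})" for x
  have pmf_R: "pmf (R x) u = q / pmf P x * (if u = e x then 1 else 0) +
      (1 - q / pmf P x) * (if m \<le> u \<and> u < m + N then 1 / N else 0)" if "x \<in> set_pmf P" for x u
  proof -
    \<comment> \<open>Minimality of \<open>q\<close> makes the ratio a valid Bernoulli
      parameter.\<close>
    have "0 \<le> q / pmf P x" "q / pmf P x \<le> 1"
      using q_le[OF that] q_pos by (auto simp: divide_le_eq_1)
    then show ?thesis
      using N_pos by (simp add: R_def pmf_bind pmf_of_set indicator_def)
  qed
  have pmf_R_name: "pmf P x * pmf (R x) (e x) = q" if "x \<in> set_pmf P" for x
    using e_less[OF that] pmf_positive[OF that] by (simp add: pmf_R[OF that])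
  \<comment> \<open>The guess is the name of the estimate of \<open>x\<close>.\<close>
  define h where "h y = e (f y)" for y
  define J where "J = leakage_coupling P R K h"
  define S where "S = {..<m + N}"
  have pmf_U: "measure_pmf.prob J {(u, x, y, v). u = s} = (\<Sum>x\<in>set_pmf P. pmf P x * pmf (R x) s)" for s
  proof -
    have "measure_pmf.prob (pair_pmf (R x) (K x)) {z. fst z = s} = pmf (R x) s" for x
      using prob_pair_pmf_Times[of "R x" "K x" "{s}" UNIV]
      by (simp add: measure_pmf_single vimage_fst[symmetric] vimage_def)
    then show ?thesis
      by (simp add: J_def prob_leakage_coupling[OF fin] case_prod_unfold)
  qed
  have pmf_U_le: "measure_pmf.prob J {(u, x, y, v). u = s} \<le> q" for s
  proof (cases "s < m")
    case True
    then obtain x where x: "x \<in> set_pmf P" "s = e x"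
      using bij_betw_imp_surj_on[OF e] by (metis atLeastLessThan_iff imageE zero_le)
    \<comment> \<open>A name is below \<open>m\<close>, out of reach of the fillers, and belongs to
      \<open>x\<close> alone, so one term survives.\<close>
    have "(\<Sum>x'\<in>set_pmf P. pmf P x' * pmf (R x') s) = (\<Sum>x'\<in>set_pmf P. if x' = x then q else 0)"
      using x e_less[of x] by (intro sum.cong) (auto simp: pmf_R e_eq set_pmf_iff)
    then show ?thesis
      using x fin by (simp add: pmf_U)
  next
    case False
    \<comment> \<open>A filler is at most \<open>q\<close> likely given each \<open>x\<close>, hence
      also on average.\<close>
    have "(\<Sum>x\<in>set_pmf P. pmf P x * pmf (R x) s) \<le> (\<Sum>x\<in>set_pmf P. pmf P x * q)"
    proof (intro sum_mono mult_left_mono)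
      fix x assume x: "x \<in> set_pmf P"
      have "0 \<le> q / pmf P x" "q / pmf P x \<le> 1"
        using q_le[OF x] q_pos by (auto simp: divide_le_eq_1)
      then have "(1 - q / pmf P x) * (if m \<le> s \<and> s < m + N then 1 / N else 0) \<le> 1 * q"
        using N_q q_pos by (intro mult_mono) auto
      with e_less[OF x] False show "pmf (R x) s \<le> q"
        by (auto simp: pmf_R[OF x])
    qed simp
    also have "\<dots> = q"
      using fin by (simp add: sum_distrib_right[symmetric] sum_pmf_eq_1)
    finally show ?thesis
      by (simp add: pmf_U)
  qed
  define M where "M = Max ((\<lambda>s. measure_pmf.prob J {(u, x, y, v). u = s}) ` S)"
  have M_le: "M \<le> q"
    unfolding M_def using pmf_U_le N_pos by (intro Max.boundedI) (auto simp: S_def)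
  have M_pos: "0 < M"
  proof -
    obtain x where x: "x \<in> set_pmf P"
      using set_pmf_not_empty[of P] by blast
    have "0 < pmf P x * pmf (R x) (e x)"
      using x q_pos by (simp add: pmf_R_name)
    also have "\<dots> \<le> (\<Sum>x'\<in>set_pmf P. pmf P x' * pmf (R x') (e x))"
      using x fin by (intro member_le_sum) auto
    also have "\<dots> \<le> M"
      unfolding M_def pmf_U[symmetric] using e_less[OF x] by (intro Max_ge) (auto simp: S_def)
    finally show ?thesis .
  qed
  have "q * (\<Sum>x\<in>set_pmf P. measure_pmf.prob (K x) {y. f y = x}) =
      (\<Sum>x\<in>set_pmf P. pmf P x * (pmf (R x) (e x) * measure_pmf.prob (K x) {y. f y = x}))"
    unfolding sum_distrib_left by (intro sum.cong) (simp_all flip: pmf_R_name)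
  also have "\<dots> \<le> measure_pmf.prob J {(u, x, y, v). u = v}"
    unfolding J_def prob_leakage_coupling[OF fin]
  proof (intro sum_mono mult_left_mono)
    fix x
    \<comment> \<open>Naming \<open>x\<close> while the estimate equals \<open>x\<close> is a
      rectangle inside the event of a correct guess.\<close>
    have "pmf (R x) (e x) * measure_pmf.prob (K x) {y. f y = x} =
        measure_pmf.prob (pair_pmf (R x) (K x)) ({e x} \<times> {y. f y = x})"
      by (simp add: prob_pair_pmf_Times measure_pmf_single)
    also have "\<dots> \<le> measure_pmf.prob (pair_pmf (R x) (K x))
        {(u, y). (u, x, y, h y) \<in> {(u, x, y, v). u = v}}"
      by (intro measure_pmf.finite_measure_mono) (auto simp: h_def)
    finally show "pmf (R x) (e x) * measure_pmf.prob (K x) {y. f y = x} \<le> \<dots>" .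
  qed simp
  finally have guess: "q * (\<Sum>x\<in>set_pmf P. measure_pmf.prob (K x) {y. f y = x}) \<le>
    measure_pmf.prob J {(u, x, y, v). u = v}" .
  have "(\<Sum>x\<in>set_pmf P. measure_pmf.prob (K x) {y. f y = x}) * M \<le>
      (\<Sum>x\<in>set_pmf P. measure_pmf.prob (K x) {y. f y = x}) * q"
    using M_le by (intro mult_left_mono sum_nonneg) auto
  with guess M_pos have "(\<Sum>x\<in>set_pmf P. measure_pmf.prob (K x) {y. f y = x}) \<le>
      measure_pmf.prob J {(u, x, y, v). u = v} / M"
    by (simp add: le_divide_eq mult.commute)
  then have "log2_ereal (\<Sum>x\<in>set_pmf P. measure_pmf.prob (K x) {y. f y = x}) \<le>
      log2_ereal (measure_pmf.prob J {(u, x, y, v). u = v} / M)"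
    by (rule log2_ereal_mono)
  also have "\<dots> \<le> maximal_leakage (joint_law P K)"
    unfolding maximal_leakage_def
  proof (intro Sup_upper CollectI exI conjI)
    show "log2_ereal (measure_pmf.prob J {(u, x, y, v). u = v} / M) =
      log2_ereal (measure_pmf.prob J {(u, x, y, v). u = v} /
        Max ((\<lambda>s. measure_pmf.prob J {(u, x, y, v). u = s}) ` S))"
      by (simp add: M_def)
    show "finite S"
      by (simp add: S_def)
    have "set_pmf (R x) \<subseteq> S" if "x \<in> set_pmf P" for x
      using e_less[OF that] N_pos by (auto simp: R_def S_def split: if_splits)
    then show "set_pmf J \<subseteq> {(u, x, y, v). u \<in> S \<and> v \<in> S}"
      using e_less[OF f] by (auto simp: J_def leakage_coupling_def S_def h_def trans_less_add1)
    show "map_pmf (\<lambda>(u, x, y, v). (x, y)) J = joint_law P K"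
      by (simp add: J_def map_leakage_coupling)
    show "markov_chain4 J (\<lambda>(u, x, y, v). u) (\<lambda>(u, x, y, v). x) (\<lambda>(u, x, y, v). y) (\<lambda>(u, x, y, v). v)"
      unfolding J_def by (rule markov_chain4_leakage_coupling[OF fin])
  qed
  finally show ?thesis .
qed

section \<open>Factorisation for memoryless schemes\<close>

text \<open>The distributive law, carried over from extensional functions: restriction to
  \<open>A\<close> is injective here because values off \<open>A\<close> are fixed to
  \<open>d\<close>.\<close>

lemma sum_PiE_dflt_prod:
  fixes F :: "'a \<Rightarrow> 'b \<Rightarrow> 'c :: comm_semiring_1"
  assumes "finite A" and "\<And>i. i \<in> A \<Longrightarrow> finite (B i)"
  shows "(\<Sum>g\<in>PiE_dflt A d B. \<Prod>i\<in>A. F i (g i)) = (\<Prod>i\<in>A. \<Sum>y\<in>B i. F i y)"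
proof -
  have inj: "inj_on (\<lambda>h. restrict h A) (PiE_dflt A d B)"
    by (force simp: inj_on_def restrict_def fun_eq_iff PiE_dflt_def)
  have "(\<Prod>i\<in>A. \<Sum>y\<in>B i. F i y) = (\<Sum>g\<in>(\<lambda>h. restrict h A) ` PiE_dflt A d B. \<Prod>i\<in>A. F i (g i))"
    unfolding restrict_PiE_dflt by (rule prod_sum_PiE) (use assms in auto)
  also have "\<dots> = (\<Sum>g\<in>PiE_dflt A d B. \<Prod>i\<in>A. F i (g i))"
    by (simp add: sum.reindex[OF inj])
  finally show ?thesis ..
qed

lemma maximal_leakage_memoryless_ge:
  assumes "set_pmf P = UNIV"
  shows "log2_ereal (\<Prod>i<n. \<Sum>c\<in>UNIV. measure_pmf.prob (W i c) {b. g i b = c}) \<le>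
    maximal_leakage (joint_law (iid_source n P) (memoryless_channel n W))"
proof -
  \<comment> \<open>The value \<open>False\<close> from \<open>n\<close> on keeps every estimate a
    word in the support of the source.\<close>
  define f where "f y = (\<lambda>i. if i < n then g i (y i) else False)" for y
  have set_iid: "set_pmf (iid_source n P) = PiE_dflt {..<n} False (\<lambda>_. UNIV)"
    by (simp add: iid_source_def set_Pi_pmf o_def assms)
  have "measure_pmf.prob (memoryless_channel n W x) {y. f y = x} =
      (\<Prod>i<n. measure_pmf.prob (W i (x i)) {b. g i b = x i})"
    if "x \<in> PiE_dflt {..<n} False (\<lambda>_. UNIV)" for x
  proof -
    \<comment> \<open>Beyond \<open>n\<close> both \<open>f y\<close> and \<open>x\<close> are
      \<open>False\<close>, so only the first \<open>n\<close> coordinates constrain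
      \<open>y\<close>.\<close>
    have "{y. f y = x} = Pi {..<n} (\<lambda>i. {b. g i b = x i})"
      using that by (auto simp: f_def PiE_dflt_def fun_eq_iff)
    then show ?thesis
      by (simp add: memoryless_channel_def measure_Pi_pmf_Pi)
  qed
  then have "(\<Sum>x\<in>set_pmf (iid_source n P). measure_pmf.prob (memoryless_channel n W x) {y. f y = x}) =
      (\<Sum>x\<in>PiE_dflt {..<n} False (\<lambda>_. UNIV). \<Prod>i<n. measure_pmf.prob (W i (x i)) {b. g i b = x i})"
    by (simp add: set_iid)
  also have "\<dots> = (\<Prod>i<n. \<Sum>c\<in>UNIV. measure_pmf.prob (W i c) {b. g i b = c})"
    by (rule sum_PiE_dflt_prod) auto
  finally have "log2_ereal (\<Prod>i<n. \<Sum>c\<in>UNIV. measure_pmf.prob (W i c) {b. g i b = c}) =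
    log2_ereal (\<Sum>x\<in>set_pmf (iid_source n P). measure_pmf.prob (memoryless_channel n W x) {y. f y = x})"
    by simp
  also have "\<dots> \<le> maximal_leakage (joint_law (iid_source n P) (memoryless_channel n W))"
  proof (rule maximal_leakage_joint_law_ge)
    show "finite (set_pmf (iid_source n P))"
      unfolding set_iid by (rule finite_PiE_dflt) auto
    show "f y \<in> set_pmf (iid_source n P)" for y
      by (simp add: set_iid f_def PiE_dflt_def)
  qed
  finally show ?thesis .
qed

section \<open>Single-letter form of the distortion\<close>

text \<open>Each output bit depends only on its own input bit, so the other coordinates marginalise
  away.\<close>

lemma map_component_joint_law:
  assumes "i < n"
  shows "map_pmf (\<lambda>(x, y). (x i, y i)) (joint_law (iid_source n P) (memoryless_channel n W)) =
    joint_law P (W i)"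
proof -
  have "map_pmf (\<lambda>(x, y). (x i, y i)) (joint_law (iid_source n P) (memoryless_channel n W)) =
      bind_pmf (iid_source n P) (\<lambda>x. map_pmf (Pair (x i)) (map_pmf (\<lambda>y. y i) (memoryless_channel n W x)))"
    by (simp add: joint_law_def map_bind_pmf pmf.map_comp o_def)
  also have "\<dots> = bind_pmf (iid_source n P) (\<lambda>x. map_pmf (Pair (x i)) (W i (x i)))"
    using assms by (simp add: memoryless_channel_def Pi_pmf_component)
  also have "\<dots> = bind_pmf (map_pmf (\<lambda>x. x i) (iid_source n P)) (\<lambda>c. map_pmf (Pair c) (W i c))"
    by (simp add: bind_map_pmf)
  also have "\<dots> = joint_law P (W i)"
    using assms by (simp add: iid_source_def Pi_pmf_component joint_law_def)
  finally show ?thesis .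
qed

lemma expectation_hamming_joint_law_bernoulli:
  fixes W :: "bool \<Rightarrow> bool pmf"
  assumes "0 \<le> p" "p \<le> 1"
  shows "measure_pmf.expectation (joint_law (bernoulli_pmf p) W) (\<lambda>(x, y). hamming x y) =
    p * (1 - pmf (W True) True) + (1 - p) * pmf (W False) True"
proof -
  have "measure_pmf.expectation (W c) (hamming c) = pmf (W c) (\<not> c)" for c
    by (subst integral_measure_pmf_real[of UNIV]) (cases c; auto simp: UNIV_bool hamming_def)+
  then show ?thesis using assms
    unfolding joint_law_def
    by (subst pmf_expectation_bind[of UNIV]) (auto simp: UNIV_bool pmf_False_conv_True)
qed

lemma expectation_hamming_n:
  assumes "0 \<le> p" "p \<le> 1"
  shows "measure_pmf.expectation (joint_law (iid_source n (bernoulli_pmf p)) (memoryless_channel n W))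
      (\<lambda>(x, y). hamming_n n x y) =
    (1 / n) * (\<Sum>i<n. p * (1 - pmf (W i True) True) + (1 - p) * pmf (W i False) True)"
proof -
  let ?Q = "joint_law (iid_source n (bernoulli_pmf p)) (memoryless_channel n W)"
  have "integrable ?Q (\<lambda>z. hamming (fst z i) (snd z i))" for i
    by (intro measure_pmf.integrable_const_bound[where B=1]) (auto simp: hamming_def)
  then have "measure_pmf.expectation ?Q (\<lambda>(x, y). hamming_n n x y) =
      (1 / n) * (\<Sum>i<n. measure_pmf.expectation ?Q (\<lambda>z. hamming (fst z i) (snd z i)))"
    by (simp add: hamming_n_def case_prod_unfold)
  also have "(\<Sum>i<n. measure_pmf.expectation ?Q (\<lambda>z. hamming (fst z i) (snd z i))) =
      (\<Sum>i<n. measure_pmf.expectation (map_pmf (\<lambda>(x, y). (x i, y i)) ?Q) (\<lambda>(x, y). hamming x y))"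
    by (simp add: case_prod_unfold)
  also have "\<dots> = (\<Sum>i<n. p * (1 - pmf (W i True) True) + (1 - p) * pmf (W i False) True)"
    by (intro sum.cong)
      (simp_all add: map_component_joint_law expectation_hamming_joint_law_bernoulli assms)
  finally show ?thesis .
qed

section \<open>Combining leakage and distortion\<close>

lemma maximal_leakage_memoryless_ge_sum:
  assumes "set_pmf P = UNIV"
  shows "ereal (\<Sum>i<n. pmf (W i True) True - pmf (W i False) True) \<le>
    maximal_leakage (joint_law (iid_source n P) (memoryless_channel n W))"
proof -
  define t where "t i = pmf (W i True) True - pmf (W i False) True" for i
  \<comment> \<open>Negating the output when \<open>t i < 0\<close> turns \<open>1 + t i\<close>
    into \<open>1 + \<bar>t i\<bar>\<close>.\<close>
  define g where "g i b = (if 0 \<le> t i then b else \<not> b)" for i b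
  have t_le: "\<bar>t i\<bar> \<le> 1" for i
    using pmf_le_1[of "W i True" True] pmf_le_1[of "W i False" True]
      pmf_nonneg[of "W i True" True] pmf_nonneg[of "W i False" True]
    unfolding t_def by linarith
  have sum_eq: "(\<Sum>c\<in>UNIV. measure_pmf.prob (W i c) {b. g i b = c}) = 1 + \<bar>t i\<bar>" for i
  proof -
    have "{b. g i b = c} = {if 0 \<le> t i then c else \<not> c}" for c
      by (auto simp: g_def)
    then show ?thesis
      by (auto simp: UNIV_bool measure_pmf_single t_def pmf_False_conv_True)
  qed
  \<comment> \<open>Positivity selects the finite branch of \<open>log2_ereal\<close>.\<close>
  have prod_pos: "0 < (\<Prod>i<n. 1 + \<bar>t i\<bar>)"
    by (intro prod_pos) auto
  have "(\<Sum>i<n. t i) \<le> (\<Sum>i<n. log 2 (1 + \<bar>t i\<bar>))"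
    using log2_one_plus_ge[OF abs_ge_zero t_le] by (intro sum_mono) (meson abs_ge_self order_trans)
  also have "\<dots> = log 2 (\<Prod>i<n. 1 + \<bar>t i\<bar>)"
    by (simp add: log_def ln_prod add_pos_nonneg sum_divide_distrib)
  finally have "ereal (\<Sum>i<n. t i) \<le> log2_ereal (\<Prod>i<n. 1 + \<bar>t i\<bar>)"
    using prod_pos by (simp add: log2_ereal_def)
  also have "\<dots> \<le> maximal_leakage (joint_law (iid_source n P) (memoryless_channel n W))"
    using maximal_leakage_memoryless_ge[OF assms, where W = W and g = g and n = n] by (simp add: sum_eq)
  finally show ?thesis
    by (simp add: t_def)
qed

theorem lemma9:
  fixes n :: nat and p D :: real
  assumes "n \<ge> 1"
    and "0 < p" and "p \<le> 1 / 2"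
    and "0 \<le> D" and "D \<le> p"
  shows "L_mem_i n (bernoulli_pmf p) D \<ge> ereal (1 - D / p)"
  unfolding L_mem_i_def
proof (rule Inf_greatest, clarify)
  fix W :: "nat \<Rightarrow> bool \<Rightarrow> bool pmf"
  let ?Q = "joint_law (iid_source n (bernoulli_pmf p)) (memoryless_channel n W)"
  assume dist: "measure_pmf.expectation ?Q (\<lambda>(x, y). hamming_n n x y) \<le> D"
  define a b where "a i = pmf (W i True) True" and "b i = pmf (W i False) True" for i
  have n: "0 < real n"
    using assms by simp
  have "(1 / n) * (\<Sum>i<n. p * (1 - a i) + (1 - p) * b i) \<le> D"
    using dist assms by (simp add: expectation_hamming_n a_def b_def)
  then have "(\<Sum>i<n. p * (1 - a i) + (1 - p) * b i) \<le> n * D"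
    using n by (simp add: field_simps)
  moreover have "(\<Sum>i<n. p * (1 - (a i - b i))) \<le> (\<Sum>i<n. p * (1 - a i) + (1 - p) * b i)"
  proof (intro sum_mono)
    fix i
    \<comment> \<open>This is where \<open>p \<le> 1 / 2\<close> enters.\<close>
    have "p * b i \<le> (1 - p) * b i"
      using assms by (intro mult_right_mono) (auto simp: b_def)
    then show "p * (1 - (a i - b i)) \<le> p * (1 - a i) + (1 - p) * b i"
      by (simp add: algebra_simps)
  qed
  ultimately have "p * (n - (\<Sum>i<n. a i - b i)) \<le> n * D"
    by (simp add: sum_distrib_left[symmetric] sum_subtractf)
  then have "1 - D / p \<le> 1 / n * (\<Sum>i<n. a i - b i)"
    using n assms by (simp add: field_simps)
  then have "ereal (1 - D / p) \<le> ereal (1 / n) * ereal (\<Sum>i<n. a i - b i)"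
    by simp
  also have "\<dots> \<le> ereal (1 / n) * maximal_leakage ?Q"
    \<comment> \<open>As \<open>0 < p < 1\<close>, both bits have positive probability, which gives
      the full support required.\<close>
    unfolding a_def b_def using assms
    by (intro ereal_mult_left_mono maximal_leakage_memoryless_ge_sum) (auto simp: set_pmf_bernoulli)
  finally show "ereal (1 - D / p) \<le> ereal (1 / n) * maximal_leakage ?Q" .
qed

end
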